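(* Let $\beta,\gamma\in[0,2)$ with $\beta+\gamma<2$. The functions $\{T_n^{\beta,\gamma}\}_{n=0,1,\dots}$ are orthogonal on $\Omega_{\beta,\gamma}=[-\cos(\beta\pi/2),\cos(\gamma\pi/2)]$ with respect to the weight function $$w^{\beta,\gamma}(x)=\frac{2}{(2-\beta-\gamma)\sqrt{1-x^2}},\quad x\in\Omega_{\beta,\gamma};$$ precisely, for all integers $r,s\ge 0$, $$\int_{\Omega_{\beta,\gamma}}T_r^{\beta,\gamma}(x)\,T_s^{\beta,\gamma}(x)\,w^{\beta,\gamma}(x)\,\mathrm{d}x=\begin{cases}0 & \text{if } r\neq s,\\ \pi & \text{if } r=s=0,\\ \frac{\pi}{2} & \text{if } r=s\neq 0.\end{cases}$$
   Context: Let $\Omega=[-1,1]$. For $\beta,\gamma\in[0,2)$ with $\beta+\gamma<2$ and an integer $n\ge 0$, the $(\beta,\gamma)$-Chebyshev function is $$T_n^{\beta,\gamma}(x)=\cos\Big(\frac{2n}{2-\beta-\gamma}\Big(\arccos x-\frac{\gamma\pi}{2}\Big)\Big),\quad x\in\Omega.$$ The weight may be singular at the endpoints $\pm1$ (when $\beta=0$ or $\gamma=0$); the integral is then the usual (Lebesgue or improper) integral. *)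

theory Defs
  imports "HOL-Analysis.Analysis"
begin

(* The functions below are total on the reals; they are only meaningful on [-1,1], where
   arccos is the genuine inverse cosine.  At the endpoints -1 and 1 the weight takes the
   conventional value 0 (division by zero); these points form a null set. *)

definition chebyshev_fun :: "real \<Rightarrow> real \<Rightarrow> nat \<Rightarrow> real \<Rightarrow> real" where
  "chebyshev_fun \<beta> \<gamma> n x = cos (2 * real n / (2 - \<beta> - \<gamma>) * (arccos x - \<gamma> * pi / 2))"

definition chebyshev_domain :: "real \<Rightarrow> real \<Rightarrow> real set" where
  "chebyshev_domain \<beta> \<gamma> = {- cos (\<beta> * pi / 2) .. cos (\<gamma> * pi / 2)}"

definition chebyshev_weight :: "real \<Rightarrow> real \<Rightarrow> real \<Rightarrow> real" where
  "chebyshev_weight \<beta> \<gamma> x = 2 / ((2 - \<beta> - \<gamma>) * sqrt (1 - x\<^sup>2))"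

end

theory Submission
  imports Defs
begin

text \<open>The substitution \<open>x = cos (\<gamma> \<pi> / 2 + (2 - \<beta> - \<gamma>) t / 2)\<close> maps \<open>[0, \<pi>]\<close> onto
  the domain and turns the weighted integral into the integral of \<open>cos (r t) * cos (s t)\<close> over
  \<open>[0, \<pi>]\<close>. The substitution is carried out on an antiderivative: it is continuous up to the
  endpoints even where the weight is singular, so the fundamental theorem of calculus applies.
  Absolute integrability follows from that of the weight, which is nonnegative
  and itself the case \<open>r = s = 0\<close>.\<close>

text \<open>Frequency 0 occurs for \<open>r = s\<close>; there the quotient would be constantly 0 by
  division by zero, so the primitive of the constant 1 is supplied instead.\<close>

definition cos_primitive :: "real \<Rightarrow> real \<Rightarrow> real" where
  "cos_primitive m t = (if m = 0 then t else sin (m * t) / m)"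

lemma cos_primitive_has_derivative:
  "(cos_primitive m has_real_derivative cos (m * t)) (at t)"
proof (cases "m = 0")
  case True
  then have "cos_primitive m = (\<lambda>t. t)"
    by (simp add: cos_primitive_def fun_eq_iff)
  with True show ?thesis by simp
next
  case False
  then have "cos_primitive m = (\<lambda>t. sin (m * t) / m)"
    by (simp add: cos_primitive_def fun_eq_iff)
  with False show ?thesis by (auto intro!: derivative_eq_intros)
qed

text \<open>This is the source of orthogonality: the sine vanishes at integer multiples of
  \<open>pi\<close>, so only frequency 0 survives.\<close>

lemma cos_primitive_pi:
  assumes "m \<in> \<int>"
  shows "cos_primitive m pi = (if m = 0 then pi else 0)"
  using assms by (auto simp: cos_primitive_def sin_integer_2pi sin_zero_iff_int2 elim!: Ints_cases)

text \<open>Encodes the product-to-sum identity. The difference is taken in the reals, since natural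
  subtraction would truncate.\<close>

definition cos_mult_primitive :: "nat \<Rightarrow> nat \<Rightarrow> real \<Rightarrow> real" where
  "cos_mult_primitive r s t =
     (cos_primitive (real r - real s) t + cos_primitive (real r + real s) t) / 2"

lemma cos_mult_primitive_has_derivative:
  "(cos_mult_primitive r s has_real_derivative cos (real r * t) * cos (real s * t)) (at t)"
proof -
  have "cos (real r * t) * cos (real s * t) =
      (cos ((real r - real s) * t) + cos ((real r + real s) * t)) / 2"
    by (simp add: cos_times_cos algebra_simps)
  then show ?thesis
    unfolding cos_mult_primitive_def
    by (auto intro!: derivative_eq_intros cos_primitive_has_derivative)
qed

text \<open>Each zero frequency contributes \<open>pi / 2\<close>: \<open>r - s\<close> vanishes
  exactly when \<open>r = s\<close>, and \<open>r + s\<close> only when both are 0.\<close>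

lemma cos_mult_primitive_diff:
  "cos_mult_primitive r s pi - cos_mult_primitive r s 0 =
     (if r \<noteq> s then 0 else if r = 0 then pi else pi / 2)"
  unfolding cos_mult_primitive_def
  by (subst (1 2) cos_primitive_pi) (auto simp: cos_primitive_def)

context
  fixes \<beta> \<gamma> :: real
  assumes beta: "0 \<le> \<beta>" "\<beta> < 2" and gamma: "0 \<le> \<gamma>" "\<gamma> < 2" and less: "\<beta> + \<gamma> < 2"
begin

text \<open>The inverse of the substitution, recovering \<open>t\<close> from
  \<open>x\<close>.\<close>

definition chebyshev_angle :: "real \<Rightarrow> real" where
  "chebyshev_angle x = 2 / (2 - \<beta> - \<gamma>) * (arccos x - \<gamma> * pi / 2)"

lemma chebyshev_fun_angle: "chebyshev_fun \<beta> \<gamma> n x = cos (real n * chebyshev_angle x)"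
  by (simp only: chebyshev_fun_def chebyshev_angle_def times_divide_eq_right
      times_divide_eq_left ac_simps)

text \<open>Puts the left endpoint in the form of a cosine of an angle in \<open>[0, pi]\<close>,
  where \<open>arccos\<close> inverts the cosine and the cosine is decreasing.\<close>

lemma lower_eq: "- cos (\<beta> * pi / 2) = cos (pi - \<beta> * pi / 2)"
  by simp

lemma angles: "0 \<le> \<gamma> * pi / 2" "\<gamma> * pi / 2 < pi - \<beta> * pi / 2" "pi - \<beta> * pi / 2 \<le> pi"
proof -
  have "(\<beta> + \<gamma>) * pi < 2 * pi" using less by (intro mult_strict_right_mono) auto
  then show "\<gamma> * pi / 2 < pi - \<beta> * pi / 2" by (simp add: field_simps)
qed (use beta gamma in auto)

lemma endpoints_less: "- cos (\<beta> * pi / 2) < cos (\<gamma> * pi / 2)"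
  unfolding lower_eq using angles by (intro cos_monotone_0_pi) auto

lemma angle_endpoints:
  "chebyshev_angle (- cos (\<beta> * pi / 2)) = pi" "chebyshev_angle (cos (\<gamma> * pi / 2)) = 0"
proof -
  have "arccos (- cos (\<beta> * pi / 2)) = pi - \<beta> * pi / 2"
    unfolding lower_eq using angles by (intro arccos_cos) linarith+
  \<comment> \<open>This is the length of the range of \<open>arccos\<close> over the domain; the
    factor in \<open>chebyshev_angle\<close> rescales it to \<open>pi\<close>.\<close>
  moreover have "pi - \<beta> * pi / 2 - \<gamma> * pi / 2 = (2 - \<beta> - \<gamma>) / 2 * pi"
    by (simp add: field_simps)
  ultimately show "chebyshev_angle (- cos (\<beta> * pi / 2)) = pi"
    using less by (simp only: chebyshev_angle_def) simp
  have "arccos (cos (\<gamma> * pi / 2)) = \<gamma> * pi / 2"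
    using angles by (intro arccos_cos) linarith+
  then show "chebyshev_angle (cos (\<gamma> * pi / 2)) = 0"
    by (simp add: chebyshev_angle_def)
qed

lemma domain_subset: "chebyshev_domain \<beta> \<gamma> \<subseteq> {-1..1}"
  by (auto simp: chebyshev_domain_def intro: order_trans[OF _ cos_le_one])

lemma continuous_on_angle: "continuous_on (chebyshev_domain \<beta> \<gamma>) chebyshev_angle"
  unfolding chebyshev_angle_def using domain_subset
  by (intro continuous_intros) auto

text \<open>The weight is the Jacobian of the substitution: \<open>arccos\<close> has derivative
  \<open>- 1 / sqrt (1 - x^2)\<close>, scaled by the constant factor of the angle.\<close>

lemma angle_has_derivative:
  assumes "-1 < x" "x < 1"
  shows "(chebyshev_angle has_real_derivative - chebyshev_weight \<beta> \<gamma> x) (at x)"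
  using DERIV_cmult[OF DERIV_diff[OF DERIV_arccos[OF assms] DERIV_const[of "\<gamma> * pi / 2"]],
      of "2 / (2 - \<beta> - \<gamma>)"]
  by (simp add: chebyshev_angle_def[abs_def] chebyshev_weight_def inverse_eq_divide)

lemma chebyshev_has_integral:
  "((\<lambda>x. chebyshev_fun \<beta> \<gamma> r x * chebyshev_fun \<beta> \<gamma> s x * chebyshev_weight \<beta> \<gamma> x)
     has_integral (if r \<noteq> s then 0 else if r = 0 then pi else pi / 2)) (chebyshev_domain \<beta> \<gamma>)"
proof -
  \<comment> \<open>The angle decreases in \<open>x\<close>; the sign cancels the minus in its
    derivative.\<close>
  let ?F = "\<lambda>x. - cos_mult_primitive r s (chebyshev_angle x)"
  have cont: "continuous_on (chebyshev_domain \<beta> \<gamma>) ?F"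
  proof -
    have "continuous_on UNIV (cos_mult_primitive r s)"
      by (meson DERIV_isCont continuous_at_imp_continuous_on cos_mult_primitive_has_derivative)
    then show ?thesis
      by (intro continuous_on_minus continuous_on_compose2[OF _ continuous_on_angle]) auto
  qed
  have deriv: "(?F has_vector_derivative
      chebyshev_fun \<beta> \<gamma> r x * chebyshev_fun \<beta> \<gamma> s x * chebyshev_weight \<beta> \<gamma> x) (at x)"
    if "x \<in> {- cos (\<beta> * pi / 2) <..< cos (\<gamma> * pi / 2)}" for x
  proof -
    \<comment> \<open>Strict even if the domain reaches -1 or 1, as \<open>x\<close> is
      interior.\<close>
    have "-1 < x" "x < 1"
      using that cos_le_one[of "\<beta> * pi / 2"] cos_le_one[of "\<gamma> * pi / 2"]
      unfolding greaterThanLessThan_iff by linarith+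
    from DERIV_minus[OF DERIV_chain2[OF cos_mult_primitive_has_derivative
        angle_has_derivative[OF this]]]
    show ?thesis
      by (simp add: chebyshev_fun_angle has_real_derivative_iff_has_vector_derivative)
  qed
  have "((\<lambda>x. chebyshev_fun \<beta> \<gamma> r x * chebyshev_fun \<beta> \<gamma> s x * chebyshev_weight \<beta> \<gamma> x)
     has_integral (?F (cos (\<gamma> * pi / 2)) - ?F (- cos (\<beta> * pi / 2)))) (chebyshev_domain \<beta> \<gamma>)"
    unfolding chebyshev_domain_def
    using fundamental_theorem_of_calculus_interior[OF less_imp_le[OF endpoints_less]
        cont[unfolded chebyshev_domain_def] deriv] .
  then show ?thesis
    using cos_mult_primitive_diff[of r s] by (simp add: angle_endpoints split: if_splits)
qed

lemma weight_absolutely_integrable: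
  "chebyshev_weight \<beta> \<gamma> absolutely_integrable_on chebyshev_domain \<beta> \<gamma>"
proof (rule nonnegative_absolutely_integrable_1)
  show "chebyshev_weight \<beta> \<gamma> integrable_on chebyshev_domain \<beta> \<gamma>"
    using chebyshev_has_integral[of 0 0] by (auto simp: chebyshev_fun_def)
next
  fix x assume "x \<in> chebyshev_domain \<beta> \<gamma>"
  then have "\<bar>x\<bar> \<le> 1" using domain_subset by (force simp: abs_le_iff)
  \<comment> \<open>At -1 and 1 the weight is 0 by division by zero.\<close>
  then show "0 \<le> chebyshev_weight \<beta> \<gamma> x"
    using less by (simp add: chebyshev_weight_def abs_square_le_1)
qed

lemma continuous_on_chebyshev_fun: "continuous_on (chebyshev_domain \<beta> \<gamma>) (chebyshev_fun \<beta> \<gamma> n)"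
  unfolding chebyshev_fun_angle[abs_def] by (intro continuous_intros continuous_on_angle)

text \<open>The product of the two Chebyshev functions is continuous on a compact interval, hence
  bounded and measurable, and the weight is absolutely integrable.\<close>

lemma chebyshev_absolutely_integrable:
  "(\<lambda>x. chebyshev_fun \<beta> \<gamma> r x * chebyshev_fun \<beta> \<gamma> s x * chebyshev_weight \<beta> \<gamma> x)
     absolutely_integrable_on chebyshev_domain \<beta> \<gamma>"
proof (rule absolutely_integrable_bounded_measurable_product_real)
  have cont: "continuous_on (chebyshev_domain \<beta> \<gamma>)
      (\<lambda>x. chebyshev_fun \<beta> \<gamma> r x * chebyshev_fun \<beta> \<gamma> s x)"
    by (intro continuous_intros continuous_on_chebyshev_fun)
  show "(\<lambda>x. chebyshev_fun \<beta> \<gamma> r x * chebyshev_fun \<beta> \<gamma> s x)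
      \<in> borel_measurable (lebesgue_on (chebyshev_domain \<beta> \<gamma>))"
    using cont by (rule continuous_imp_measurable_on_sets_lebesgue) (simp add: chebyshev_domain_def)
  show "bounded ((\<lambda>x. chebyshev_fun \<beta> \<gamma> r x * chebyshev_fun \<beta> \<gamma> s x) ` chebyshev_domain \<beta> \<gamma>)"
    using cont by (intro compact_imp_bounded compact_continuous_image)
      (simp_all add: chebyshev_domain_def)
qed (simp_all add: chebyshev_domain_def weight_absolutely_integrable[unfolded chebyshev_domain_def])

text \<open>Needed to pass from the completed Lebesgue measure to \<open>lborel\<close>. The
  indicator is grouped with the cosine factors, whose continuity is known on the domain only; the
  weight is Borel on the whole line.\<close>

lemma chebyshev_indicator_measurable:
  "(\<lambda>x. indicator (chebyshev_domain \<beta> \<gamma>) x *\<^sub>R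
     (chebyshev_fun \<beta> \<gamma> r x * chebyshev_fun \<beta> \<gamma> s x * chebyshev_weight \<beta> \<gamma> x))
     \<in> borel_measurable lborel"
proof -
  have "(\<lambda>x. indicator (chebyshev_domain \<beta> \<gamma>) x *\<^sub>R
      (chebyshev_fun \<beta> \<gamma> r x * chebyshev_fun \<beta> \<gamma> s x)) \<in> borel_measurable borel"
    by (intro borel_measurable_continuous_on_indicator continuous_intros
        continuous_on_chebyshev_fun) (simp add: chebyshev_domain_def)
  moreover have "chebyshev_weight \<beta> \<gamma> \<in> borel_measurable borel"
    unfolding chebyshev_weight_def by measurable
  ultimately have "(\<lambda>x. (indicator (chebyshev_domain \<beta> \<gamma>) x *\<^sub>R
      (chebyshev_fun \<beta> \<gamma> r x * chebyshev_fun \<beta> \<gamma> s x)) * chebyshev_weight \<beta> \<gamma> x)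
      \<in> borel_measurable borel"
    by (rule borel_measurable_times)
  then show ?thesis by (simp add: mult.assoc)
qed

end

theorem theorem1:
  fixes \<beta> \<gamma> :: real and r s :: nat
  assumes "\<beta> \<in> {0..<2}" and "\<gamma> \<in> {0..<2}" and "\<beta> + \<gamma> < 2"
  shows "set_integrable lborel (chebyshev_domain \<beta> \<gamma>)
           (\<lambda>x. chebyshev_fun \<beta> \<gamma> r x * chebyshev_fun \<beta> \<gamma> s x * chebyshev_weight \<beta> \<gamma> x) \<and>
         (LBINT x:chebyshev_domain \<beta> \<gamma>.
            chebyshev_fun \<beta> \<gamma> r x * chebyshev_fun \<beta> \<gamma> s x * chebyshev_weight \<beta> \<gamma> x) =
         (if r \<noteq> s then 0 else if r = 0 then pi else pi / 2)"
proof -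
  let ?f = "\<lambda>x. chebyshev_fun \<beta> \<gamma> r x * chebyshev_fun \<beta> \<gamma> s x * chebyshev_weight \<beta> \<gamma> x"
  have *: "0 \<le> \<beta>" "\<beta> < 2" "0 \<le> \<gamma>" "\<gamma> < 2" "\<beta> + \<gamma> < 2" using assms by auto
  note meas = chebyshev_indicator_measurable[OF *, of r s]
  have int: "set_integrable lborel (chebyshev_domain \<beta> \<gamma>) ?f"
    using chebyshev_absolutely_integrable[OF *, of r s]
    unfolding set_integrable_def integrable_completion[OF meas] .
  \<comment> \<open>Given integrability, the Lebesgue integral equals the gauge integral, whose
    value is known.\<close>
  have "(LBINT x:chebyshev_domain \<beta> \<gamma>. ?f x) = integral (chebyshev_domain \<beta> \<gamma>) ?f"
    by (rule set_borel_integral_eq_integral(2)[OF int])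
  also have "\<dots> = (if r \<noteq> s then 0 else if r = 0 then pi else pi / 2)"
    by (rule integral_unique[OF chebyshev_has_integral[OF *]])
  finally show ?thesis using int by blast
qed

end
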